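(* Let $p>3$ be a prime. Then there exist at least $p-1$ pairwise non-isomorphic $2$-generated groups of order $p^6$ that are not Beauville groups.
   Context: Let $G$ be a finite group with identity $e$. For $x,y\in G$ put $$\Sigma(x,y):=\bigcup_{i=1}^{|G|}\bigcup_{g\in G}\{(x^i)^g,(y^i)^g,((xy)^i)^g\},$$ where $a^g$ denotes the conjugate $g^{-1}ag$. A Beauville structure for $G$ is a pair of generating sets $\{x_1,y_1\},\{x_2,y_2\}$ of $G$ (i.e. $\langle x_1,y_1\rangle=\langle x_2,y_2\rangle=G$) such that $\Sigma(x_1,y_1)\cap\Sigma(x_2,y_2)=\{e\}$. $G$ is a Beauville group if there exists a Beauville structure for $G$. A group is $2$-generated if it can be generated by two elements. *)

theory Defs
  imports "HOL-Algebra.Generated_Groups" "HOL-Computational_Algebra.Primes"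
begin

definition conjugate :: "('a, 'b) monoid_scheme \<Rightarrow> 'a \<Rightarrow> 'a \<Rightarrow> 'a"
  where "conjugate G a g = inv\<^bsub>G\<^esub> g \<otimes>\<^bsub>G\<^esub> a \<otimes>\<^bsub>G\<^esub> g"

definition Sigma_set :: "('a, 'b) monoid_scheme \<Rightarrow> 'a \<Rightarrow> 'a \<Rightarrow> 'a set"
  where "Sigma_set G x y =
    (\<Union>i\<in>{1..order G}. \<Union>g\<in>carrier G.
      {conjugate G (x [^]\<^bsub>G\<^esub> (i::nat)) g,
       conjugate G (y [^]\<^bsub>G\<^esub> i) g,
       conjugate G ((x \<otimes>\<^bsub>G\<^esub> y) [^]\<^bsub>G\<^esub> i) g})"

definition generating_pair :: "('a, 'b) monoid_scheme \<Rightarrow> 'a \<Rightarrow> 'a \<Rightarrow> bool"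
  where "generating_pair G x y \<longleftrightarrow>
    x \<in> carrier G \<and> y \<in> carrier G \<and> generate G {x, y} = carrier G"

definition two_generated :: "('a, 'b) monoid_scheme \<Rightarrow> bool"
  where "two_generated G \<longleftrightarrow> (\<exists>x y. generating_pair G x y)"

text \<open>The pairs are given as ordered pairs; since \<open>xy\<close> and \<open>yx\<close> are conjugate,
  \<open>Sigma_set G x y = Sigma_set G y x\<close> in a group.\<close>

definition beauville_structure ::
    "('a, 'b) monoid_scheme \<Rightarrow> 'a \<Rightarrow> 'a \<Rightarrow> 'a \<Rightarrow> 'a \<Rightarrow> bool"
  where "beauville_structure G x1 y1 x2 y2 \<longleftrightarrow>
    generating_pair G x1 y1 \<and> generating_pair G x2 y2 \<and>
    Sigma_set G x1 y1 \<inter> Sigma_set G x2 y2 = {\<one>\<^bsub>G\<^esub>}"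

definition beauville_group :: "('a, 'b) monoid_scheme \<Rightarrow> bool"
  where "beauville_group G \<longleftrightarrow> (\<exists>x1 y1 x2 y2. beauville_structure G x1 y1 x2 y2)"

end

theory Submission
  imports Defs "HOL-Number_Theory.Cong" "HOL-Algebra.Weak_Morphisms" "HOL-Library.Countable"
begin

text \<open>
  For a residue \<open>e\<close> modulo \<open>p\<close> let \<open>t\<close> act on \<open>R = \<int>/p\<^sup>3 \<oplus> \<int>/p\<close> as \<open>exp D\<close>, where \<open>D(1, 0) = (p, 1)\<close> and
  \<open>D(0, 1) = ((2e - 1)p\<^sup>2, 0)\<close>, so that \<open>D\<^sup>2(1, 0) = (2ep\<^sup>2, 0)\<close> and \<open>D\<^sup>3 = 0\<close>; the groups are the
  semidirect products of \<open>R\<close> by the cyclic group of order \<open>p\<^sup>2\<close> generated by \<open>t\<close>.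
  Raising to the power \<open>p\<^sup>2\<close> sends \<open>(i, j)t\<^sup>n\<close> to \<open>(p\<^sup>2 i, 0)\<close>. Hence every element outside the proper
  subgroup \<open>p | i\<close> has the central element \<open>(p\<^sup>2, 0)\<close> as a power, and every generating pair contains
  such an element, so any two sets \<open>\<Sigma>(x, y)\<close> share this element.
  The residue \<open>e\<close> is an isomorphism invariant: if \<open>t\<^bsup>p\<^sup>2\<^esup> = 1\<close>, \<open>x\<^bsup>p\<^sup>2\<^esup> \<noteq> 1\<close> and \<open>[x, t]\<^sup>p = x\<^bsup>p\<^sup>2\<^esup>\<close>,
  then \<open>[[x, t], t] = x\<^bsup>2ep\<^sup>2\<^esup>\<close>.
\<close>

section \<open>Isomorphism invariance\<close>

lemma generating_pair_iso_image:
  assumes "group G" "group H" and h: "h \<in> iso G H" and "generating_pair G x y"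
  shows "generating_pair H (h x) (h y)"
proof -
  interpret group_hom G H h
    using assms by (simp add: group_hom_def group_hom_axioms_def iso_def)
  have xy: "x \<in> carrier G" "y \<in> carrier G" "generate G {x, y} = carrier G"
    using assms(4) by (auto simp: generating_pair_def)
  have "generate H (h ` {x, y}) = h ` carrier G"
    using generate_img[of "{x, y}"] xy by simp
  also have "\<dots> = carrier H"
    using h by (simp add: iso_def bij_betw_def)
  finally show ?thesis
    using xy by (simp add: generating_pair_def)
qed

lemma Sigma_set_iso_image:
  assumes "group G" "group H" and h: "h \<in> iso G H" and x: "x \<in> carrier G" and y: "y \<in> carrier G"
  shows "Sigma_set H (h x) (h y) = h ` Sigma_set G x y"
proof -
  interpret group_hom G H h
    using assms by (simp add: group_hom_def group_hom_axioms_def iso_def)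
  have carr: "carrier H = h ` carrier G" and ord: "order H = order G"
    using h iso_same_card[OF is_isoI[OF h]] by (auto simp: iso_def bij_betw_def order_def)
  have conj: "conjugate H (h a [^]\<^bsub>H\<^esub> i) (h g) = h (conjugate G (a [^]\<^bsub>G\<^esub> i) g)"
    if "a \<in> carrier G" "g \<in> carrier G" for a g and i :: nat
    using that by (simp add: conjugate_def hom_nat_pow)
  have conj': "{conjugate H (h x [^]\<^bsub>H\<^esub> i) (h g), conjugate H (h y [^]\<^bsub>H\<^esub> i) (h g),
      conjugate H ((h x \<otimes>\<^bsub>H\<^esub> h y) [^]\<^bsub>H\<^esub> i) (h g)} =
    h ` {conjugate G (x [^]\<^bsub>G\<^esub> i) g, conjugate G (y [^]\<^bsub>G\<^esub> i) g,
      conjugate G ((x \<otimes>\<^bsub>G\<^esub> y) [^]\<^bsub>G\<^esub> i) g}"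
    if "g \<in> carrier G" for g and i :: nat
    using x y that conj[of x g i] conj[of y g i] conj[of "x \<otimes>\<^bsub>G\<^esub> y" g i] by simp
  show ?thesis
    unfolding Sigma_set_def ord carr image_UN image_image by (simp only: conj' cong: SUP_cong)
qed

lemma beauville_group_iso:
  assumes G: "group G" and H: "group H" and "G \<cong> H" and "beauville_group G"
  shows "beauville_group H"
proof -
  obtain h where h: "h \<in> iso G H"
    using assms(3) by (auto simp: is_iso_def)
  obtain x1 y1 x2 y2 where b: "generating_pair G x1 y1" "generating_pair G x2 y2"
    "Sigma_set G x1 y1 \<inter> Sigma_set G x2 y2 = {\<one>\<^bsub>G\<^esub>}"
    using assms(4) by (auto simp: beauville_group_def beauville_structure_def)
  interpret G: group G by fact
  have carr: "x1 \<in> carrier G" "y1 \<in> carrier G" "x2 \<in> carrier G" "y2 \<in> carrier G"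
    using b by (auto simp: generating_pair_def)
  have sub: "Sigma_set G x y \<subseteq> carrier G" if "x \<in> carrier G" "y \<in> carrier G" for x y
    using that by (auto simp: Sigma_set_def conjugate_def)
  have inj: "inj_on h (carrier G)"
    using h by (simp add: iso_def bij_betw_def)
  \<comment> \<open>Injectivity makes the intersection of the images the image of the intersection,
    which is \<open>{\<one>}\<close>.\<close>
  have "Sigma_set H (h x1) (h y1) \<inter> Sigma_set H (h x2) (h y2) = {\<one>\<^bsub>H\<^esub>}"
    using inj_on_image_Int[OF inj sub sub, of x1 y1 x2 y2] b(3) carr
      hom_one[of h G H] h G H
    by (simp add: Sigma_set_iso_image[OF G H h] iso_def)
  then show ?thesis
    using b generating_pair_iso_image[OF G H h]
    unfolding beauville_group_def beauville_structure_def by blast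
qed

lemma two_generated_iso:
  assumes "group G" "group H" and "G \<cong> H" and "two_generated G"
  shows "two_generated H"
  using assms generating_pair_iso_image[of G H] unfolding two_generated_def is_iso_def by blast

section \<open>A criterion for not being Beauville\<close>

lemma (in group) not_beauville_group_if_common_power:
  assumes N: "subgroup N G" "N \<noteq> carrier G"
    and z: "z \<noteq> \<one>"
    and pow: "\<And>g. g \<in> carrier G \<Longrightarrow> g \<notin> N \<Longrightarrow> \<exists>i\<in>{1..order G}. g [^] i = z"
  shows "\<not> beauville_group G"
proof
  have in_Sigma: "z \<in> Sigma_set G x y" if gen: "generating_pair G x y" for x y
  proof -
    have xy: "x \<in> carrier G" "y \<in> carrier G" "generate G {x, y} = carrier G"
      using gen by (auto simp: generating_pair_def)
    \<comment> \<open>Otherwise the whole group, being generated by \<open>x\<close> and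
      \<open>y\<close>, would lie in \<open>N\<close>.\<close>
    have "x \<notin> N \<or> y \<notin> N"
      using generate_subgroup_incl[OF _ N(1), of "{x, y}"] N(2) xy(3) subgroup.subset[OF N(1)]
      by blast
    then obtain i where i: "i \<in> {1..order G}" "x [^] i = z \<or> y [^] i = z"
      using pow xy(1,2) by blast
    have "conjugate G (x [^] i) \<one> = x [^] i" "conjugate G (y [^] i) \<one> = y [^] i"
      using xy by (auto simp: conjugate_def)
    then show ?thesis
      unfolding Sigma_set_def using i one_closed by (intro UN_I[of i] UN_I[of \<one>]) auto
  qed
  assume "beauville_group G"
  then obtain x1 y1 x2 y2 where "generating_pair G x1 y1" "generating_pair G x2 y2"
    "Sigma_set G x1 y1 \<inter> Sigma_set G x2 y2 = {\<one>}"
    by (auto simp: beauville_group_def beauville_structure_def)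
  with in_Sigma z show False by blast
qed

section \<open>The groups\<close>

text \<open>The triple \<open>(i, j, n)\<close> stands for \<open>(i, j)t\<^sup>n\<close>, and \<open>t\<^sup>n\<close> acts as \<open>1 + nD + n\<^sup>2/2 D\<^sup>2\<close>; choosing
  \<open>D\<^sup>2(1, 0)\<close> as the double \<open>2ep\<^sup>2\<close> avoids the denominator. The product \<open>rmul\<close> on integer triples
  is associative only after reduction.\<close>

definition red :: "int \<Rightarrow> int \<times> int \<times> int \<Rightarrow> int \<times> int \<times> int"
  where "red p = (\<lambda>(i, j, n). (i mod p ^ 3, j mod p, n mod p ^ 2))"

fun rmul :: "int \<Rightarrow> int \<Rightarrow> int \<times> int \<times> int \<Rightarrow> int \<times> int \<times> int \<Rightarrow> int \<times> int \<times> int"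
  where "rmul p e (i, j, n) (i', j', n') =
    (i + (i' + n * p * i' + p ^ 2 * (n * (2 * e - 1) * j' + n ^ 2 * e * i')),
     j + (j' + n * i'), n + n')"

definition Grp :: "int \<Rightarrow> int \<Rightarrow> (int \<times> int \<times> int) monoid"
  where "Grp p e = \<lparr>carrier = {0..<p ^ 3} \<times> {0..<p} \<times> {0..<p ^ 2},
    monoid.mult = (\<lambda>x y. red p (rmul p e x y)), one = (0, 0, 0)\<rparr>"

lemma carrier_Grp: "carrier (Grp p e) = {0..<p ^ 3} \<times> {0..<p} \<times> {0..<p ^ 2}"
  and mult_Grp: "x \<otimes>\<^bsub>Grp p e\<^esub> y = red p (rmul p e x y)"
  and one_Grp: "\<one>\<^bsub>Grp p e\<^esub> = (0, 0, 0)"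
  by (simp_all add: Grp_def)

section \<open>Residue arithmetic and the group axioms\<close>

lemma red_eq_iff:
  "red p (i, j, n) = red p (i', j', n') \<longleftrightarrow>
    [i = i'] (mod p ^ 3) \<and> [j = j'] (mod p) \<and> [n = n'] (mod p ^ 2)"
  by (simp add: red_def cong_def)

lemma red_carrier [simp]: "x \<in> carrier (Grp p e) \<Longrightarrow> red p x = x"
  by (auto simp: carrier_Grp red_def)

lemma red_in_carrier [simp]: "p > 0 \<Longrightarrow> red p x \<in> carrier (Grp p e)"
  by (auto simp: carrier_Grp red_def split: prod.split)

lemma red_red [simp]: "red p (red p x) = red p x"
  by (simp add: red_def split: prod.split)

lemma cong_scale_modulus: "[a = b] (mod m) \<Longrightarrow> [k * a = k * b] (mod k * m)" for a b k m :: int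
  by (simp add: cong_def mod_mult_mult1)

text \<open>Although \<open>n\<close> is known only modulo \<open>p ^ 2\<close>, the extra factor
  \<open>p\<close> determines \<open>n * p * k\<close> modulo \<open>p ^ 3\<close>, and the terms
  with factor \<open>p ^ 2\<close> need only residues modulo \<open>p\<close>.\<close>

lemma red_rmul_cong:
  assumes "red p x = red p x'" "red p y = red p y'"
  shows "red p (rmul p e x y) = red p (rmul p e x' y')"
proof -
  obtain i j n k l m where x: "x = (i, j, n)" and y: "y = (k, l, m)"
    by (metis prod_cases3)
  obtain i' j' n' k' l' m' where x': "x' = (i', j', n')" and y': "y' = (k', l', m')"
    by (metis prod_cases3)
  have c: "[i = i'] (mod p ^ 3)" "[j = j'] (mod p)" "[n = n'] (mod p ^ 2)"
    "[k = k'] (mod p ^ 3)" "[l = l'] (mod p)" "[m = m'] (mod p ^ 2)"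
    using assms by (simp_all add: x y x' y' red_eq_iff)
  have k2: "[k = k'] (mod p ^ 2)" and k1: "[k = k'] (mod p)" and n1: "[n = n'] (mod p)"
    using c(3,4) by (auto elim!: cong_dvd_modulus simp: power2_eq_square power3_eq_cube)
  have "[p * (n * k) = p * (n' * k')] (mod p * p ^ 2)"
    by (intro cong_scale_modulus cong_mult c k2)
  moreover have "[p ^ 2 * (n * (2 * e - 1) * l + n ^ 2 * e * k)
      = p ^ 2 * (n' * (2 * e - 1) * l' + n' ^ 2 * e * k')] (mod p ^ 2 * p)"
    by (intro cong_scale_modulus cong_mult cong_add cong_pow c n1 k1 cong_refl)
  ultimately have F: "[n * p * k = n' * p * k'] (mod p ^ 3)"
    "[p ^ 2 * (n * (2 * e - 1) * l + n ^ 2 * e * k)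
      = p ^ 2 * (n' * (2 * e - 1) * l' + n' ^ 2 * e * k')] (mod p ^ 3)"
    by (simp_all add: power2_eq_square power3_eq_cube mult_ac)
  then show ?thesis
    unfolding x y x' y' rmul.simps red_eq_iff
    using cong_add[OF c(1) cong_add[OF cong_add[OF c(4) F(1)] F(2)]]
      cong_add[OF c(2) cong_add[OF c(5) cong_mult[OF n1 k1]]] cong_add[OF c(3) c(6)]
    by (intro conjI)
qed

lemma red_rmul_red [simp]:
  "red p (rmul p e (red p x) y) = red p (rmul p e x y)"
  "red p (rmul p e x (red p y)) = red p (rmul p e x y)"
  by (rule red_rmul_cong; simp)+

text \<open>This is exp(nD) exp(n'D) = exp((n + n')D): the cross terms
  \<open>n * p * (n' * p * k)\<close> and \<open>p ^ 2 * (n * (2 * e - 1) * (n' * k))\<close> add up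
  to \<open>p ^ 2 * (2 * n * n' * e * k)\<close>, and what is left over vanishes on
  reduction.\<close>

lemma red_rmul_assoc: "red p (rmul p e (rmul p e x y) z) = red p (rmul p e x (rmul p e y z))"
proof -
  obtain i j n i' j' n' k l m where x: "x = (i, j, n)" and y: "y = (i', j', n')" and z: "z = (k, l, m)"
    by (metis prod_cases3)
  define B where "B = n' * (2 * e - 1) * l + n' ^ 2 * e * k"
  have "p ^ 3 dvd i + (i' + n * p * i' + p ^ 2 * (n * (2 * e - 1) * j' + n ^ 2 * e * i')) +
      (k + (n + n') * p * k + p ^ 2 * ((n + n') * (2 * e - 1) * l + (n + n') ^ 2 * e * k)) -
    (i + (i' + (k + n' * p * k + p ^ 2 * B) + n * p * (i' + (k + n' * p * k + p ^ 2 * B)) +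
      p ^ 2 * (n * (2 * e - 1) * (j' + (l + n' * k)) +
        n ^ 2 * e * (i' + (k + n' * p * k + p ^ 2 * B)))))"
    by (rule dvdI[where k = "- (n * B + n ^ 2 * e * (n' * k + p * B))"])
      (simp add: B_def algebra_simps power2_eq_square power3_eq_cube)
  moreover have "p dvd j + (j' + n * i') + (l + (n + n') * k) -
    (j + (j' + (l + n' * k) + n * (i' + (k + n' * p * k + p ^ 2 * B))))"
    by (rule dvdI[where k = "- (n * (n' * k + p * B))"])
      (simp add: algebra_simps power2_eq_square)
  ultimately show ?thesis
    by (simp add: x y z red_eq_iff cong_iff_dvd_diff B_def add.assoc)
qed

lemma group_Grp:
  assumes "p > 0"
  shows "group (Grp p e)"
proof (rule groupI, goal_cases)
  case (3 x y z)
  then show ?case by (simp add: mult_Grp red_rmul_assoc)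
next
  case (4 x)
  obtain i j n where "x = (i, j, n)" by (metis prod_cases3)
  then show ?case using red_carrier[OF 4] by (simp add: mult_Grp one_Grp)
next
  case (5 x)
  obtain i j n where x: "x = (i, j, n)" by (metis prod_cases3)
  \<comment> \<open>The first two entries are minus the image of \<open>(i, j)\<close> under t^(-n),
    which gives an exact left inverse even before reduction.\<close>
  define y where "y = (- (i + (- n) * p * i + p ^ 2 * ((- n) * (2 * e - 1) * j + (- n) ^ 2 * e * i)),
    - (j + (- n) * i), - n)"
  have "rmul p e y x = (0, 0, 0)"
    by (simp add: x y_def)
  then have "red p y \<otimes>\<^bsub>Grp p e\<^esub> x = \<one>\<^bsub>Grp p e\<^esub>"
    by (simp add: mult_Grp one_Grp) (simp add: red_def)
  then show ?case using assms red_in_carrier by blast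
qed (use assms in \<open>auto simp: mult_Grp carrier_Grp one_Grp red_def split: prod.split\<close>)

section \<open>Order and powers\<close>

lemma order_Grp:
  assumes "p > 0"
  shows "order (Grp p e) = nat p ^ 6"
  using assms by (simp add: order_def carrier_Grp card_cartesian_product nat_power_eq
      flip: power_add power_Suc)

text \<open>Exponents of the form \<open>nat k\<close> have to stay natural powers, the form in
  which \<open>pow_Grp\<close> is stated.\<close>

declare pow_nat [simp del]

text \<open>The m-th power of (i, j)t^n is the sum of t^(nk)(i, j) over k < m, times t^(nm); the
  linear and quadratic terms of the action produce the two power sums.\<close>

lemma pow_Grp:
  assumes "p > 0"
  shows "red p (i, j, n) [^]\<^bsub>Grp p e\<^esub> (m::nat) =
    red p (int m * i + n * p * i * (\<Sum>k<m. int k) + p ^ 2 * (n * (2 * e - 1) * j * (\<Sum>k<m. int k) +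
      n ^ 2 * e * i * (\<Sum>k<m. int k ^ 2)), int m * j + n * i * (\<Sum>k<m. int k), int m * n)"
proof (induction m)
  case 0
  then show ?case by (simp add: one_Grp nat_pow_def) (simp add: red_def)
next
  case (Suc m)
  interpret group "Grp p e" by (rule group_Grp[OF assms])
  show ?case
    by (simp add: Suc mult_Grp red_in_carrier[OF assms]) 
      (simp add: algebra_simps power2_eq_square)
qed

lemma pow_Grp_abelian:
  assumes "p > 0"
  shows "red p (i, j, 0) [^]\<^bsub>Grp p e\<^esub> (m::nat) = red p (int m * i, int m * j, 0)"
  using pow_Grp[OF assms, of e i j 0 m] by simp

lemma sum_int_lessThan: "2 * (\<Sum>k<m. int k) = int m * (int m - 1)"
  by (induction m) (simp_all add: algebra_simps)

lemma sum_int_squares_lessThan: "6 * (\<Sum>k<m. int k ^ 2) = int m * (int m - 1) * (2 * int m - 1)"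
  by (induction m) (simp_all add: algebra_simps power2_eq_square)

text \<open>The closed forms of the power sums have denominators 2 and 6, which are coprime to
  \<open>p\<close> because \<open>p > 3\<close>. Hence \<open>p ^ 2\<close> divides the first sum
  and \<open>p\<close> the second, enough to remove every term but \<open>p ^ 2 * i\<close>.\<close>

lemma pow_p2_Grp:
  fixes p :: int
  assumes p: "Factorial_Ring.prime p" "p > 3" and x: "(i, j, n) \<in> carrier (Grp p e)"
  shows "(i, j, n) [^]\<^bsub>Grp p e\<^esub> nat (p ^ 2) = red p (p ^ 2 * i, 0, 0)"
proof -
  let ?m = "nat (p ^ 2)"
  have m: "int ?m = p ^ 2" by simp
  have not_dvd: "\<not> p dvd 2" "\<not> p dvd 3"
    using p(2) by (auto dest!: zdvd_imp_le)
  then have "\<not> p dvd 2 * 3"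
    using p(1) prime_dvd_mult_iff by blast
  then have "coprime p 2" "coprime p 6"
    using not_dvd p(1) by (auto intro: prime_imp_coprime simp del: coprime_right_2_iff_odd)
  then have cop: "coprime (p ^ 2) 2" "coprime p 6"
    by simp_all
  have "p ^ 2 dvd 2 * (\<Sum>k<?m. int k)"
    unfolding sum_int_lessThan m by simp
  then obtain a where a: "(\<Sum>k<?m. int k) = p ^ 2 * a"
    using cop by (auto simp: coprime_dvd_mult_right_iff)
  have "p dvd 6 * (\<Sum>k<?m. int k ^ 2)"
    unfolding sum_int_squares_lessThan m by (simp add: power2_eq_square)
  then obtain b where b: "(\<Sum>k<?m. int k ^ 2) = p * b"
    using cop by (auto simp: coprime_dvd_mult_right_iff)
  have "p ^ 3 dvd (p ^ 2 * i + n * p * i * (p ^ 2 * a) + p ^ 2 * (n * (2 * e - 1) * j * (p ^ 2 * a) +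
      n ^ 2 * e * i * (p * b))) - p ^ 2 * i"
    by (rule dvdI[where k = "n * i * a + n * (2 * e - 1) * j * p * a + n ^ 2 * e * i * b"])
      (simp add: algebra_simps power2_eq_square power3_eq_cube)
  moreover have "p dvd p ^ 2 * j + n * i * (p ^ 2 * a)"
    by (simp add: power2_eq_square)
  ultimately have "red p (i, j, n) [^]\<^bsub>Grp p e\<^esub> ?m = red p (p ^ 2 * i, 0, 0)"
    using p(2) by (simp add: pow_Grp a b m red_eq_iff cong_iff_dvd_diff)
  then show ?thesis
    using x by simp
qed

lemma red_p2_eq_iff:
  assumes "p \<noteq> 0"
  shows "red p (p ^ 2 * a, 0, 0) = red p (p ^ 2 * b, 0, 0) \<longleftrightarrow> [a = b] (mod p)"
  using assms by (simp add: red_eq_iff cong_iff_dvd_diff power2_eq_square power3_eq_cube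
      flip: right_diff_distrib)

section \<open>Generation by two elements and failure of the Beauville property\<close>

lemma two_generated_Grp:
  assumes "p > 1"
  shows "two_generated (Grp p e)"
proof -
  have p: "p > 0" using assms by simp
  interpret group "Grp p e" by (rule group_Grp[OF p])
  let ?G = "Grp p e"
  \<comment> \<open>\<open>(u, 1)\<close> is the image of \<open>(1, 0)\<close> under t, so the
    conjugate of \<open>x\<close> by \<open>t\<close> supplies the second coordinate.\<close>
  define u where "u = 1 + p + p ^ 2 * e"
  define x where "x = red p (1, 0, 0)"
  define t where "t = red p (0, 0, 1)"
  define H where "H = generate ?G {x, t}"
  have xt: "{x, t} \<subseteq> carrier ?G"
    using p by (simp add: x_def t_def)
  then have H: "subgroup H ?G"
    unfolding H_def by (rule generate_is_subgroup)
  have xH: "x \<in> H" and tH: "t \<in> H"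
    by (auto simp: H_def intro: generate.incl)
  have "red p (u, 1, 0) \<otimes>\<^bsub>?G\<^esub> t = t \<otimes>\<^bsub>?G\<^esub> x"
    by (simp add: mult_Grp x_def t_def u_def)
  then have "red p (u, 1, 0) = t \<otimes>\<^bsub>?G\<^esub> x \<otimes>\<^bsub>?G\<^esub> inv\<^bsub>?G\<^esub> t"
    using inv_solve_right[of "red p (u, 1, 0)" "t \<otimes>\<^bsub>?G\<^esub> x" t] xt p by simp
  then have uH: "red p (u, 1, 0) \<in> H"
    using xH tH H by (simp add: subgroup.m_closed subgroup.m_inv_closed)
  have powH: "h [^]\<^bsub>?G\<^esub> (m::nat) \<in> H" if "h \<in> H" for h m
    using that H by (induction m) (auto simp: subgroup.one_closed subgroup.m_closed)
  have "red p (i, j, n) \<in> H" if "0 \<le> j" "0 \<le> n" for i j n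
  proof -
    \<comment> \<open>\<open>k\<close> corrects the first coordinate \<open>u * j\<close> of the
      j-th power of \<open>(u, 1, 0)\<close>.\<close>
    define k where "k = nat ((i - u * j) mod p ^ 3)"
    have k: "int k = (i - u * j) mod p ^ 3"
      using p by (simp add: k_def)
    have "red p (int k, 0, 0) \<in> H" "red p (j * u, j, 0) \<in> H" "red p (0, 0, n) \<in> H"
      using powH[OF xH, of k] powH[OF uH, of "nat j"] powH[OF tH, of "nat n"] that
      by (simp_all add: x_def t_def pow_Grp[OF p])
    then have "red p (int k, 0, 0) \<otimes>\<^bsub>?G\<^esub> red p (j * u, j, 0) \<otimes>\<^bsub>?G\<^esub> red p (0, 0, n) \<in> H"
      using H by (simp add: subgroup.m_closed)
    moreover have "red p (int k, 0, 0) \<otimes>\<^bsub>?G\<^esub> red p (j * u, j, 0) \<otimes>\<^bsub>?G\<^esub> red p (0, 0, n)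
        = red p (i, j, n)"
      by (simp add: mult_Grp) (simp add: k red_eq_iff cong_def mod_simps mult.commute)
    ultimately show ?thesis by simp
  qed
  then have "red p y \<in> H" if "y \<in> carrier ?G" for y
    using that by (auto simp: carrier_Grp simp del: red_carrier)
  then have "y \<in> H" if "y \<in> carrier ?G" for y
    using that by (metis red_carrier)
  then have "carrier ?G \<subseteq> H" by blast
  then have "generating_pair ?G x t"
    using xt subgroup.subset[OF H] by (auto simp: generating_pair_def H_def)
  then show ?thesis
    unfolding two_generated_def by blast
qed

lemma not_beauville_Grp:
  fixes p :: int
  assumes p: "Factorial_Ring.prime p" "p > 3"
  shows "\<not> beauville_group (Grp p e)"
proof -
  have p0: "p > 0" using p by simp
  interpret group "Grp p e" by (rule group_Grp[OF p0])
  let ?G = "Grp p e"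
  define N where "N = {(i, j, n) \<in> carrier ?G. p dvd i}"
  have fin: "finite (carrier ?G)" by (simp add: carrier_Grp)
  have dvd_mod: "p dvd a mod p ^ 3 \<longleftrightarrow> p dvd a" for a
    by (rule dvd_mod_iff) simp
  \<comment> \<open>\<open>N\<close> is the kernel of the first coordinate modulo \<open>p\<close>.
    The equivalence, taken at the inverse of \<open>x\<close>, also yields closure under
    inverses.\<close>
  have mult_N: "x \<otimes>\<^bsub>?G\<^esub> y \<in> N \<longleftrightarrow> y \<in> N"
    if "x \<in> N" "y \<in> carrier ?G" for x y
    using that red_in_carrier[OF p0, of "rmul p e x y" e]
    by (auto simp: N_def mult_Grp red_def dvd_mod power2_eq_square dvd_add_right_iff
        dvd_add_left_iff split: prod.splits)
  have "subgroup N ?G"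
  proof (rule subgroupI)
    fix x assume x: "x \<in> N"
    then have "x \<in> carrier ?G" by (auto simp: N_def)
    moreover have "\<one>\<^bsub>?G\<^esub> \<in> N" using one_closed by (simp add: N_def one_Grp)
    ultimately show "inv\<^bsub>?G\<^esub> x \<in> N"
      using mult_N[OF x, of "inv\<^bsub>?G\<^esub> x"] by simp
  next
    fix x y assume "x \<in> N" "y \<in> N"
    then show "x \<otimes>\<^bsub>?G\<^esub> y \<in> N"
      using mult_N[of x y] by (auto simp: N_def)
  qed (use one_closed in \<open>auto simp: N_def one_Grp\<close>)
  moreover have "(1, 0, 0) \<in> carrier ?G - N"
    using p by (auto simp: carrier_Grp N_def)
  then have "N \<noteq> carrier ?G" by blast
  moreover have "red p (p ^ 2 * 1, 0, 0) \<noteq> \<one>\<^bsub>?G\<^esub>"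
    using red_p2_eq_iff[of p 1 0] p by (auto simp: one_Grp red_def cong_iff_dvd_diff)
  ultimately show ?thesis
  proof (rule not_beauville_group_if_common_power, goal_cases)
    case (1 g)
    obtain i j n where g: "g = (i, j, n)" by (metis prod_cases3)
    with 1 have "\<not> p dvd i" by (auto simp: N_def)
    then have "coprime i p"
      using p(1) prime_imp_coprime coprime_commute by blast
    then obtain v where v: "[i * v = 1] (mod p)"
      using cong_solve_coprime_int by blast
    \<comment> \<open>\<open>m\<close> inverts \<open>i\<close> modulo \<open>p\<close> and so turns
      \<open>(p ^ 2 * i, 0, 0)\<close> into an element independent of \<open>g\<close>.\<close>
    define m where "m = nat (v mod p)"
    have m: "int m = v mod p" using p0 by (simp add: m_def)
    have "g [^]\<^bsub>?G\<^esub> (nat (p ^ 2) * m) = red p (p ^ 2 * i, 0, 0) [^]\<^bsub>?G\<^esub> m"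
      using 1 pow_p2_Grp[OF p, of i j n e] by (simp add: g flip: nat_pow_pow)
    also have "\<dots> = red p (p ^ 2 * (int m * i), 0, 0)"
      using pow_Grp_abelian[OF p0, of e "p ^ 2 * i" 0 m] by (simp add: mult_ac)
    also have "\<dots> = red p (p ^ 2 * 1, 0, 0)"
      using v p0 by (subst red_p2_eq_iff) (auto simp: m cong_def mod_simps mult.commute)
    finally have eq: "g [^]\<^bsub>?G\<^esub> (nat (p ^ 2) * m) = red p (p ^ 2 * 1, 0, 0)" .
    have "m > 0"
      using v p m by (cases "m = 0") (auto simp: cong_def mod_eq_0_iff_dvd)
    \<comment> \<open>This bounds the exponent by \<open>p ^ 2 * p ^ 4\<close>, the group order, as
      the range of \<open>i\<close> in \<open>Sigma_set\<close> demands.\<close>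
    moreover have "m < nat p" using p0 by (simp add: m_def)
    then have "nat p ^ 2 * m \<le> nat p ^ 2 * nat p ^ 4"
      using p0 by (intro mult_left_mono order.trans[OF less_imp_le self_le_power]) auto
    ultimately have "nat (p ^ 2) * m \<in> {1..order ?G}"
      using p0 by (simp add: order_Grp nat_power_eq flip: power_add)
    with eq show ?case by blast
  qed
qed

section \<open>The isomorphism invariant\<close>

text \<open>The element \<open>c\<close> is the commutator \<open>[x, t]\<close> and \<open>d\<close> is \<open>[c, t]\<close>, written without inverses;
  the hypothesis \<open>cp\<close> normalises the choice of \<open>t\<close>.\<close>

lemma Grp_invariant:
  fixes p :: int
  assumes p: "Factorial_Ring.prime p" "p > 3" and e: "e \<ge> 0"
    and carr: "x \<in> carrier (Grp p e)" "t \<in> carrier (Grp p e)"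
      "c \<in> carrier (Grp p e)" "d \<in> carrier (Grp p e)"
    and x: "x [^]\<^bsub>Grp p e\<^esub> nat (p ^ 2) \<noteq> \<one>\<^bsub>Grp p e\<^esub>"
    and t: "t [^]\<^bsub>Grp p e\<^esub> nat (p ^ 2) = \<one>\<^bsub>Grp p e\<^esub>"
    and c: "x \<otimes>\<^bsub>Grp p e\<^esub> t = c \<otimes>\<^bsub>Grp p e\<^esub> (t \<otimes>\<^bsub>Grp p e\<^esub> x)"
    and cp: "c [^]\<^bsub>Grp p e\<^esub> nat p = x [^]\<^bsub>Grp p e\<^esub> nat (p ^ 2)"
    and d: "c \<otimes>\<^bsub>Grp p e\<^esub> t = d \<otimes>\<^bsub>Grp p e\<^esub> (t \<otimes>\<^bsub>Grp p e\<^esub> c)"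
  shows "d = x [^]\<^bsub>Grp p e\<^esub> (nat (p ^ 2) * nat (2 * e))"
proof -
  have p0: "p > 0" using p by simp
  interpret group "Grp p e" by (rule group_Grp[OF p0])
  obtain i j n i' j' n' where xt: "x = (i, j, n)" "t = (i', j', n')"
    by (metis prod_cases3)
  obtain C1 C2 C3 D1 D2 D3 where cd: "c = (C1, C2, C3)" "d = (D1, D2, D3)"
    by (metis prod_cases3)
  have xp: "x [^]\<^bsub>Grp p e\<^esub> nat (p ^ 2) = red p (p ^ 2 * i, 0, 0)"
    and tp: "t [^]\<^bsub>Grp p e\<^esub> nat (p ^ 2) = red p (p ^ 2 * i', 0, 0)"
    using pow_p2_Grp[OF p] carr by (simp_all add: xt)
  have one: "\<one>\<^bsub>Grp p e\<^esub> = red p (p ^ 2 * 0, 0, 0)"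
    by (simp add: one_Grp red_def)
  have i: "\<not> p dvd i" and "p dvd i'"
    using x t p0 unfolding xp tp one by (simp_all only: red_p2_eq_iff cong_0_iff simp_thms)
  then obtain a where a: "i' = p * a" by blast
  have c_raw: "red p (rmul p e x t) = red p (rmul p e c (rmul p e t x))"
    using c by (simp add: mult_Grp)
  have d_raw: "red p (rmul p e c t) = red p (rmul p e d (rmul p e t c))"
    using d by (simp add: mult_Grp)
  \<comment> \<open>Third coordinates add, so the rest cancels modulo \<open>p ^ 2\<close>; the
    carrier bounds turn the congruence into equality.\<close>
  have C3: "C3 = 0" and D3: "D3 = 0"
    using c_raw d_raw carr
    by (auto simp: xt cd red_eq_iff cong_iff_dvd_diff carrier_Grp dest: zdvd_imp_le)
  obtain k1 where k1: "i + (i' + n * p * i' + p ^ 2 * (n * (2 * e - 1) * j' + n ^ 2 * e * i')) -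
      (C1 + (i' + (i + n' * p * i + p ^ 2 * (n' * (2 * e - 1) * j + n' ^ 2 * e * i)))) = p ^ 3 * k1"
    using c_raw by (auto simp: xt cd C3 red_eq_iff cong_iff_dvd_diff)
  obtain k2 where k2: "j + (j' + n * i') - (C2 + (j' + (j + n' * i))) = p * k2"
    using c_raw by (auto simp: xt cd C3 red_eq_iff cong_iff_dvd_diff)
  have "red p (p * C1, p * C2, 0) = red p (p ^ 2 * i, 0, 0)"
    using pow_Grp_abelian[OF p0, of e C1 C2 "nat p"] carr(3) cp p0 by (simp add: cd C3 xp)
  then obtain k3 where "p * C1 - p ^ 2 * i = p ^ 3 * k3"
    by (auto simp: red_eq_iff cong_iff_dvd_diff)
  then have "p * C1 = p * (p * i + p ^ 2 * k3)"
    by (simp add: algebra_simps power2_eq_square power3_eq_cube)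
  then have k3: "C1 = p * i + p ^ 2 * k3"
    using p0 by simp
  \<comment> \<open>Modulo \<open>p ^ 2\<close> the commutator equation gives \<open>C1\<close> as
    \<open>- n' * p * i\<close>, while \<open>cp\<close> gave \<open>p * i\<close>. Since
    \<open>p\<close> does not divide \<open>i\<close>, \<open>n'\<close> must be -1 modulo
    \<open>p\<close>.\<close>
  have "p * (i * (1 + n')) = p * (p * (n * a + n * (2 * e - 1) * j' + n ^ 2 * e * i'
      - n' * (2 * e - 1) * j - n' ^ 2 * e * i - p * k1 - k3))"
    using k1 unfolding k3 a by (simp add: algebra_simps power2_eq_square power3_eq_cube)
  then have "p dvd i * (1 + n')"
    using p0 by (metis dvd_triv_left mult_cancel_left less_irrefl)
  then obtain l where "1 + n' = p * l"
    using i p(1) by (auto simp: prime_dvd_mult_iff)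
  then have l: "n' = p * l - 1" by simp
  have C2: "C2 = i + p * (n * a - l * i - k2)"
    using k2 unfolding a l by (simp add: algebra_simps)
  obtain k4 where k4: "C1 + i' -
      (D1 + (i' + (C1 + n' * p * C1 + p ^ 2 * (n' * (2 * e - 1) * C2 + n' ^ 2 * e * C1)))) = p ^ 3 * k4"
    using d_raw by (auto simp: xt cd C3 D3 red_eq_iff cong_iff_dvd_diff)
  obtain k5 where k5: "C2 + j' - (D2 + (j' + (C2 + n' * C1))) = p * k5"
    using d_raw by (auto simp: xt cd C3 D3 red_eq_iff cong_iff_dvd_diff)
  \<comment> \<open>Modulo \<open>p ^ 3\<close>, the first term contributes \<open>p ^ 2 * i\<close>
    and the one with \<open>C2\<close> contributes \<open>p ^ 2 * (2 * e - 1) * i\<close>; the last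
    term with \<open>C1\<close> vanishes, as \<open>p\<close> divides \<open>C1\<close>.\<close>
  have "D1 = - (n' * p * C1) - p ^ 2 * (n' * (2 * e - 1) * C2 + n' ^ 2 * e * C1) - p ^ 3 * k4"
    using k4 by simp
  also have "\<dots> = p ^ 2 * (2 * e * i) + p ^ 3 * (k3 - l * i - p * l * k3
      - l * (2 * e - 1) * C2 + (2 * e - 1) * (n * a - l * i - k2)
      - n' ^ 2 * e * (i + p * k3) - k4)"
    unfolding k3 C2 l by (simp add: algebra_simps power2_eq_square power3_eq_cube)
  finally have "p ^ 3 dvd D1 - p ^ 2 * (2 * e * i)"
    by simp
  moreover have "D2 = p * (- (n' * (i + p * k3)) - k5)"
    using k5 unfolding k3 by (simp add: algebra_simps power2_eq_square)
  then have "p dvd D2" by simp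
  ultimately have "red p d = red p (p ^ 2 * (2 * e * i), 0, 0)"
    by (simp add: cd D3 red_eq_iff cong_iff_dvd_diff)
  also have "\<dots> = red p (p ^ 2 * i, 0, 0) [^]\<^bsub>Grp p e\<^esub> nat (2 * e)"
    using pow_Grp_abelian[OF p0, of e "p ^ 2 * i" 0 "nat (2 * e)"] e by (simp add: mult_ac)
  also have "\<dots> = x [^]\<^bsub>Grp p e\<^esub> (nat (p ^ 2) * nat (2 * e))"
    using carr by (simp flip: xp nat_pow_pow)
  finally show ?thesis using carr by simp
qed

lemma Grp_iso_imp_eq:
  fixes p :: int
  assumes p: "Factorial_Ring.prime p" "p > 3" and e: "e \<in> {0..<p}" and f: "f \<in> {0..<p}"
    and "Grp p f \<cong> Grp p e"
  shows "e = f"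
proof -
  have p0: "p > 0" using p by simp
  let ?F = "Grp p f" and ?E = "Grp p e"
  obtain h where h: "h \<in> iso ?F ?E"
    using assms(5) by (auto simp: is_iso_def)
  interpret group_hom ?F ?E h
    using h group_Grp[OF p0] by (simp add: group_hom_def group_hom_axioms_def iso_def)
  have inj: "inj_on h (carrier ?F)"
    using h by (simp add: iso_def bij_betw_def)
  define x where "x = red p (1, 0, 0)"
  \<comment> \<open>The exponent -1 is the value modulo \<open>p\<close> that the normalisation
    \<open>cp\<close> forces. Then \<open>c\<close> is \<open>(1, 0)\<close> minus its image under
    exp(-D), and \<open>d\<close> arises from \<open>c\<close> in the same way.\<close>
  define t where "t = red p (0, 0, -1)"
  define c where "c = red p (p - p ^ 2 * f, 1, 0)"
  define d where "d = red p (p ^ 2 * (2 * f), 0, 0)"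
  have carr: "x \<in> carrier ?F" "t \<in> carrier ?F" "c \<in> carrier ?F" "d \<in> carrier ?F"
    using p0 by (auto simp: x_def t_def c_def d_def)
  have x_pow: "x [^]\<^bsub>?F\<^esub> (m::nat) = red p (int m, 0, 0)" for m
    using pow_Grp_abelian[OF p0, of f 1 0 m] by (simp add: x_def)
  have one: "\<one>\<^bsub>?F\<^esub> = red p (0, 0, 0)"
    by (simp add: one_Grp red_def)
  have x: "x [^]\<^bsub>?F\<^esub> nat (p ^ 2) \<noteq> \<one>\<^bsub>?F\<^esub>"
    using red_p2_eq_iff[of p 1 0] p by (simp add: x_pow one cong_0_iff)
  have t: "t [^]\<^bsub>?F\<^esub> nat (p ^ 2) = \<one>\<^bsub>?F\<^esub>"
    using p0 by (simp add: t_def pow_Grp one red_eq_iff cong_iff_dvd_diff)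
  have c: "x \<otimes>\<^bsub>?F\<^esub> t = c \<otimes>\<^bsub>?F\<^esub> (t \<otimes>\<^bsub>?F\<^esub> x)"
    by (simp add: mult_Grp x_def t_def c_def)
  have cp: "c [^]\<^bsub>?F\<^esub> nat p = x [^]\<^bsub>?F\<^esub> nat (p ^ 2)"
    using p0 by (simp add: c_def x_pow pow_Grp_abelian red_eq_iff cong_iff_dvd_diff
        algebra_simps power2_eq_square power3_eq_cube)
  have "p ^ 3 dvd p - p ^ 2 * f - (p ^ 2 * (2 * f) + ((p - p ^ 2 * f) - p * (p - p ^ 2 * f)
      + p ^ 2 * (- (2 * f - 1) + f * (p - p ^ 2 * f))))"
    by (rule dvdI[where k = "- f - f * (1 - p * f)"])
      (simp add: algebra_simps power2_eq_square power3_eq_cube)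
  moreover have "p dvd 1 - (1 - (p - p ^ 2 * f))"
    by (simp add: power2_eq_square)
  ultimately have d: "c \<otimes>\<^bsub>?F\<^esub> t = d \<otimes>\<^bsub>?F\<^esub> (t \<otimes>\<^bsub>?F\<^esub> c)"
    by (simp add: mult_Grp t_def c_def d_def red_eq_iff cong_iff_dvd_diff)
  \<comment> \<open>The relations are carried to \<open>?E\<close>, where the invariant involves
    \<open>e\<close>; pulled back along the injective \<open>h\<close>, it is compared with the
    explicit \<open>d\<close>, which involves \<open>f\<close>.\<close>
  have "h d = h x [^]\<^bsub>?E\<^esub> (nat (p ^ 2) * nat (2 * e))"
  proof (rule Grp_invariant[OF p, where t = "h t" and c = "h c"])
    show "h x [^]\<^bsub>?E\<^esub> nat (p ^ 2) \<noteq> \<one>\<^bsub>?E\<^esub>"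
      using x inj_on_eq_iff[OF inj G.nat_pow_closed[OF carr(1)] G.one_closed]
      unfolding hom_nat_pow[OF carr(1)] hom_one by blast
    show "h t [^]\<^bsub>?E\<^esub> nat (p ^ 2) = \<one>\<^bsub>?E\<^esub>"
      unfolding hom_nat_pow[OF carr(2), symmetric] t by (rule hom_one)
    show "h c [^]\<^bsub>?E\<^esub> nat p = h x [^]\<^bsub>?E\<^esub> nat (p ^ 2)"
      unfolding hom_nat_pow[OF carr(1), symmetric] hom_nat_pow[OF carr(3), symmetric] cp ..
    show "h x \<otimes>\<^bsub>?E\<^esub> h t = h c \<otimes>\<^bsub>?E\<^esub> (h t \<otimes>\<^bsub>?E\<^esub> h x)"
      using arg_cong[OF c, of h] carr by simp
    show "h c \<otimes>\<^bsub>?E\<^esub> h t = h d \<otimes>\<^bsub>?E\<^esub> (h t \<otimes>\<^bsub>?E\<^esub> h c)"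
      using arg_cong[OF d, of h] carr by simp
  qed (use carr e in auto)
  also have "\<dots> = h (x [^]\<^bsub>?F\<^esub> (nat (p ^ 2) * nat (2 * e)))"
    using carr by (simp only: hom_nat_pow)
  finally have "d = x [^]\<^bsub>?F\<^esub> (nat (p ^ 2) * nat (2 * e))"
    using carr inj_on_eq_iff[OF inj] by simp
  then have "red p (p ^ 2 * (2 * f), 0, 0) = red p (p ^ 2 * (2 * e), 0, 0)"
    using e by (simp add: d_def x_pow)
  then have "[2 * f = 2 * e] (mod p)"
    using p0 by (subst (asm) red_p2_eq_iff) auto
  moreover have "coprime 2 p"
    using p prime_odd_int[of p] by simp
  ultimately have "[f = e] (mod p)"
    using cong_mult_lcancel by blast
  then show ?thesis
    using e f by (simp add: cong_def)
qed

theorem theorem6: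
  fixes p :: nat
  assumes "Factorial_Ring.prime p" and "p > 3"
  shows "\<exists>\<G> :: nat monoid set.
    finite \<G> \<and> card \<G> \<ge> p - 1 \<and>
    (\<forall>G\<in>\<G>. group G \<and> order G = p ^ 6 \<and> two_generated G \<and> \<not> beauville_group G) \<and>
    (\<forall>G\<in>\<G>. \<forall>H\<in>\<G>. G \<noteq> H \<longrightarrow> \<not> G \<cong> H)"
proof -
  have p: "Factorial_Ring.prime (int p)" "int p > 3" "int p > 1" "int p > 0"
    using assms by auto
  \<comment> \<open>Copying along \<open>to_nat\<close> moves the groups to the type
    \<open>nat\<close> that the statement asks for.\<close>
  define K :: "int \<Rightarrow> nat monoid" where "K e = image_group to_nat (Grp (int p) e)" for e
  have group_G: "group (Grp (int p) e)" for e
    using p by (simp add: group_Grp)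
  have group_K: "group (K e)" and iso: "Grp (int p) e \<cong> K e" for e
    unfolding K_def
    using group.inj_imp_image_group_is_group[OF group_G] inj_imp_image_group_iso
      inj_on_subset[OF inj_to_nat subset_UNIV] is_isoI by blast+
  note iso' = group.iso_sym[OF group_G iso]
  have eq: "e = f" if "e \<in> {0..<int p}" "f \<in> {0..<int p}" "K f \<cong> K e" for e f
    using Grp_iso_imp_eq[OF p(1,2) that(1,2)] iso_trans[OF iso iso_trans[OF that(3) iso']] .
  \<comment> \<open>Equal monoids are isomorphic, so \<open>eq\<close> also separates the groups as
    elements of the set, giving all \<open>p\<close> of them.\<close>
  have inj: "inj_on K {0..<int p}"
    by (rule inj_onI) (metis eq iso_refl)
  show ?thesis
  proof (intro exI[of _ "K ` {0..<int p}"] conjI ballI impI)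
    show "card (K ` {0..<int p}) \<ge> p - 1"
      by (simp add: card_image[OF inj])
  next
    fix G assume "G \<in> K ` {0..<int p}"
    then obtain e where G: "G = K e" by blast
    show "group G" using group_K G by simp
    show "order G = p ^ 6"
      using iso_same_card[OF iso[of e]] order_Grp[OF p(4), of e] by (simp add: G order_def)
    show "two_generated G"
      using two_generated_iso[OF group_G group_K iso two_generated_Grp[OF p(3)]] by (simp add: G)
    show "\<not> beauville_group G"
      using beauville_group_iso[OF group_K group_G iso'] not_beauville_Grp[OF p(1,2)] by (auto simp: G)
  next
    fix G H assume "G \<in> K ` {0..<int p}" "H \<in> K ` {0..<int p}" "G \<noteq> H"
    then show "\<not> G \<cong> H" using eq by blast
  qed simp
qed

end
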